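(* Let $G$ be a linear algebraic group over an algebraically closed field $\Bbbk$ of arbitrary characteristic. Suppose $G$ contains a non-trivial torus. Then $\sigma(G)=\infty$.
   Context: A $G$-module is a finite-dimensional rational representation $V$ of $G$ over $\Bbbk$. $\Bbbk[V]\cong S(V^* )$ is the ring of polynomial functions on $V$, with $G$-action $(g\cdot f)(v)=f(g^{-1}v)$ and invariant ring $\Bbbk[V]^G$, graded by degree. $\Bbbk[V]^G_{\le d}$ is the set of invariants of degree at most $d$. For $S\subseteq \Bbbk[V]$, $S_+$ is the set of elements of $S$ with constant term zero. The nullcone $\mathcal{N}_{G,V}\subseteq V$ is the common zero set of $\Bbbk[V]^G_+$. A subset $S\subseteq\Bbbk[V]^G$ is a $\sigma$-set if for every $v\in V\setminus\mathcal{N}_{G,V}$ there is $f\in S_+$ with $f(v)\neq 0$. Define $\sigma(G,V)=\min\{d\ge 0 : \Bbbk[V]^G_{\le d}\text{ is a }\sigma\text{-set}\}$ and $\sigma(G)=\sup\{\sigma(G,V): V\text{ a }G\text{-module}\}$ (equal to $\infty$ if unbounded). *)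

theory Defs
  imports
    "Jordan_Normal_Form.Determinant"
    "HOL-Computational_Algebra.Polynomial"
    "HOL-Library.Extended_Nat"
begin

section \<open>Polynomial functions\<close>

definition exponents :: "'i set \<Rightarrow> nat \<Rightarrow> ('i \<Rightarrow> nat) set" where
  "exponents I d = {\<alpha>. (\<forall>i. i \<notin> I \<longrightarrow> \<alpha> i = 0) \<and> (\<Sum>i\<in>I. \<alpha> i) \<le> d}"

text \<open>The polynomial expressions below are sums over this set, so its finiteness matters.\<close>

lemma finite_exponents:
  assumes "finite I"
  shows "finite (exponents I d)"
proof (rule finite_subset)
  show "exponents I d \<subseteq> {\<alpha>. \<forall>i. (i \<in> I \<longrightarrow> \<alpha> i \<in> {..d}) \<and> (i \<notin> I \<longrightarrow> \<alpha> i = 0)}"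
  proof
    fix \<alpha> :: "'a \<Rightarrow> nat"
    assume "\<alpha> \<in> exponents I d"
    then have 1: "\<forall>i. i \<notin> I \<longrightarrow> \<alpha> i = 0" and 2: "(\<Sum>i\<in>I. \<alpha> i) \<le> d"
      by (auto simp: exponents_def)
    have "\<alpha> i \<le> d" if "i \<in> I" for i
      using member_le_sum[of i I \<alpha>] that assms 2 by auto
    with 1 show "\<alpha> \<in> {\<alpha>. \<forall>i. (i \<in> I \<longrightarrow> \<alpha> i \<in> {..d}) \<and> (i \<notin> I \<longrightarrow> \<alpha> i = 0)}"
      by auto
  qed
qed (use assms in \<open>intro finite_set_of_finite_funs; simp\<close>)

text \<open>
  Functions that agree on \<open>X\<close> with a polynomial of total degree at most \<open>d\<close> in the coordinate
  functions \<open>x i\<close>, \<open>i \<in> I\<close>. The values outside \<open>X\<close> are arbitrary and never used.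
\<close>

definition polynomial_functions_le ::
    "('i \<Rightarrow> 'x \<Rightarrow> 'k) \<Rightarrow> 'i set \<Rightarrow> 'x set \<Rightarrow> nat \<Rightarrow> ('x \<Rightarrow> 'k::comm_ring_1) set" where
  "polynomial_functions_le x I X d =
     {f. \<exists>c. \<forall>v\<in>X. f v = (\<Sum>\<alpha>\<in>exponents I d. c \<alpha> * (\<Prod>i\<in>I. x i v ^ \<alpha> i))}"

definition matrix_polynomials :: "nat \<Rightarrow> ('k::comm_ring_1 mat \<Rightarrow> 'k) set" where
  "matrix_polynomials n =
     (\<Union>d. polynomial_functions_le (\<lambda>ij A. A $$ ij) ({..<n} \<times> {..<n}) (carrier_mat n n) d)"


section \<open>Linear algebraic groups\<close>

abbreviation GL :: "nat \<Rightarrow> 'k::field mat monoid" where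
  "GL n \<equiv> units_of (ring_mat TYPE('k) n ())"

text \<open>
  A linear algebraic group is a Zariski-closed subgroup of some \<open>GL n\<close>. The set \<open>E\<close> of equations
  may be infinite; by Hilbert's basis theorem this makes no difference.
\<close>

definition zariski_closed_in_GL :: "nat \<Rightarrow> 'k::field mat set \<Rightarrow> bool" where
  "zariski_closed_in_GL n G \<longleftrightarrow>
     (\<exists>E \<subseteq> matrix_polynomials n. G = {A \<in> carrier (GL n). \<forall>P\<in>E. P A = 0})"

definition linear_algebraic_group :: "nat \<Rightarrow> 'k::field mat set \<Rightarrow> bool" where
  "linear_algebraic_group n G \<longleftrightarrow> subgroup G (GL n) \<and> zariski_closed_in_GL n G"

text \<open>The coordinate ring of a closed subset of \<open>GL n\<close> is generated by the matrix entries and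
  the inverse of the determinant.\<close>

definition regular_functions :: "nat \<Rightarrow> 'k::field mat set \<Rightarrow> ('k mat \<Rightarrow> 'k) set" where
  "regular_functions n G =
     {f. \<exists>P \<in> matrix_polynomials n. \<exists>k::nat. \<forall>A\<in>G. f A = P A / det A ^ k}"

definition algebraic_group_homs ::
    "nat \<Rightarrow> 'k::field mat set \<Rightarrow> nat \<Rightarrow> 'k mat set \<Rightarrow> ('k mat \<Rightarrow> 'k mat) set" where
  "algebraic_group_homs n G m H =
     {\<phi> \<in> hom (GL n\<lparr>carrier := G\<rparr>) (GL m\<lparr>carrier := H\<rparr>).
        \<forall>i<m. \<forall>j<m. (\<lambda>A. \<phi> A $$ (i, j)) \<in> regular_functions n G}"

definition algebraic_group_iso ::
    "nat \<Rightarrow> 'k::field mat set \<Rightarrow> nat \<Rightarrow> 'k mat set \<Rightarrow> bool" where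
  "algebraic_group_iso n G m H \<longleftrightarrow>
     (\<exists>\<phi> \<in> algebraic_group_homs n G m H. \<exists>\<psi> \<in> algebraic_group_homs m H n G.
        (\<forall>A\<in>G. \<psi> (\<phi> A) = A) \<and> (\<forall>B\<in>H. \<phi> (\<psi> B) = B))"

text \<open>The group of invertible diagonal matrices of size \<open>r\<close> is the \<open>r\<close>-fold power of the
  multiplicative group of the field.\<close>

definition diagonal_group :: "nat \<Rightarrow> 'k::field mat set" where
  "diagonal_group r = {A \<in> carrier (GL r). diagonal_mat A}"

definition torus :: "nat \<Rightarrow> 'k::field mat set \<Rightarrow> bool" where
  "torus n T \<longleftrightarrow>
     linear_algebraic_group n T \<and> (\<exists>r. algebraic_group_iso n T r (diagonal_group r))"


section \<open>Modules, invariants and the nullcone\<close>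

text \<open>
  A \<open>G\<close>-module of dimension \<open>m\<close>, written in coordinates: the vector space is \<open>carrier_vec m\<close>
  and \<open>g\<close> acts on it by the matrix \<open>\<rho> g\<close>.
\<close>

definition rational_representations ::
    "nat \<Rightarrow> 'k::field mat set \<Rightarrow> nat \<Rightarrow> ('k mat \<Rightarrow> 'k mat) set" where
  "rational_representations n G m = algebraic_group_homs n G m (carrier (GL m))"

definition vector_polynomials_le :: "nat \<Rightarrow> nat \<Rightarrow> ('k::comm_ring_1 vec \<Rightarrow> 'k) set" where
  "vector_polynomials_le m d =
     polynomial_functions_le (\<lambda>i v. v $ i) {..<m} (carrier_vec m) d"

definition invariants_le ::
    "nat \<Rightarrow> 'k::field mat set \<Rightarrow> nat \<Rightarrow> ('k mat \<Rightarrow> 'k mat) \<Rightarrow> nat \<Rightarrow> ('k vec \<Rightarrow> 'k) set" where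
  "invariants_le n G m \<rho> d =
     {f \<in> vector_polynomials_le m d.
        \<forall>g\<in>G. \<forall>v\<in>carrier_vec m. f (\<rho> (inv\<^bsub>GL n\<^esub> g) *\<^sub>v v) = f v}"

definition invariants ::
    "nat \<Rightarrow> 'k::field mat set \<Rightarrow> nat \<Rightarrow> ('k mat \<Rightarrow> 'k mat) \<Rightarrow> ('k vec \<Rightarrow> 'k) set" where
  "invariants n G m \<rho> = (\<Union>d. invariants_le n G m \<rho> d)"

text \<open>The constant term of a polynomial function is its value at the origin.\<close>

definition plus_part :: "nat \<Rightarrow> ('k::field vec \<Rightarrow> 'k) set \<Rightarrow> ('k vec \<Rightarrow> 'k) set" where
  "plus_part m S = {f \<in> S. f (0\<^sub>v m) = 0}"

definition nullcone ::
    "nat \<Rightarrow> 'k::field mat set \<Rightarrow> nat \<Rightarrow> ('k mat \<Rightarrow> 'k mat) \<Rightarrow> 'k vec set" where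
  "nullcone n G m \<rho> =
     {v \<in> carrier_vec m. \<forall>f \<in> plus_part m (invariants n G m \<rho>). f v = 0}"


section \<open>The invariant sigma\<close>

definition sigma_set ::
    "nat \<Rightarrow> 'k::field mat set \<Rightarrow> nat \<Rightarrow> ('k mat \<Rightarrow> 'k mat) \<Rightarrow> ('k vec \<Rightarrow> 'k) set \<Rightarrow> bool" where
  "sigma_set n G m \<rho> S \<longleftrightarrow>
     S \<subseteq> invariants n G m \<rho> \<and>
     (\<forall>v \<in> carrier_vec m - nullcone n G m \<rho>. \<exists>f \<in> plus_part m S. f v \<noteq> 0)"

text \<open>
  The infimum is a minimum: the nullcone is cut out by finitely many invariants, so the
  set of admissible \<open>d\<close> is never empty.
\<close>

definition sigma_module ::
    "nat \<Rightarrow> 'k::field mat set \<Rightarrow> nat \<Rightarrow> ('k mat \<Rightarrow> 'k mat) \<Rightarrow> enat" where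
  "sigma_module n G m \<rho> = (INF d \<in> {d. sigma_set n G m \<rho> (invariants_le n G m \<rho> d)}. enat d)"

definition sigma_group :: "nat \<Rightarrow> 'k::field mat set \<Rightarrow> enat" where
  "sigma_group n G =
     (SUP (m, \<rho>) \<in> {(m, \<rho>). \<rho> \<in> rational_representations n G m}. sigma_module n G m \<rho>)"

end

theory Submission
  imports Defs
begin

text \<open>
  Let \<open>U\<close> be the \<open>n\<close>-dimensional space on which \<open>G\<close> acts as a matrix group. The module
  \<open>V = U \<oplus> (U\<^sup>*)\<^sup>\<otimes>\<^sup>N\<close> has the invariant \<open>(x, \<omega>) \<mapsto> \<omega>(x, \<dots>, x)\<close> in every characteristic. A non-trivial
  torus contains an element \<open>t\<close> of prime order \<open>q\<close> for every prime \<open>q\<close> different from the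
  characteristic, and such a \<open>t\<close> has an eigenvector \<open>e\<close> and a dual eigenvector \<open>\<epsilon>\<close> for the same
  eigenvalue of order \<open>q\<close> with \<open>\<epsilon>(e) \<noteq> 0\<close>. At \<open>v = (e, \<epsilon>\<^sup>\<otimes>\<^sup>N)\<close> the invariant takes the value
  \<open>\<epsilon>(e)\<^sup>N\<close>, so \<open>v\<close> lies outside the nullcone. On the other hand, \<open>t\<close> acts on the two
  components of \<open>v\<close> with weights \<open>1\<close> and \<open>-N\<close> modulo \<open>q\<close>, so for \<open>q > N\<^sup>2\<close> no monomial of positive
  degree at most \<open>N\<close> in these components is \<open>t\<close>-invariant. Hence \<open>\<sigma>(G, V) > N\<close>.
\<close>

section \<open>Polynomial and regular functions\<close>

abbreviation polynomial_functions ::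
    "('i \<Rightarrow> 'x \<Rightarrow> 'k) \<Rightarrow> 'i set \<Rightarrow> 'x set \<Rightarrow> ('x \<Rightarrow> 'k::comm_ring_1) set" where
  "polynomial_functions x I X \<equiv> (\<Union>d. polynomial_functions_le x I X d)"

lemma polynomial_functions_le_mono:
  assumes "finite I" "d \<le> d'" "f \<in> polynomial_functions_le x I X d"
  shows "f \<in> polynomial_functions_le x I X d'"
proof -
  obtain c where c: "\<forall>v\<in>X. f v = (\<Sum>\<alpha>\<in>exponents I d. c \<alpha> * (\<Prod>i\<in>I. x i v ^ \<alpha> i))"
    using assms(3) unfolding polynomial_functions_le_def by auto
  have sub: "exponents I d \<subseteq> exponents I d'"
    using assms(2) by (auto simp: exponents_def)
  have "(\<Sum>\<alpha>\<in>exponents I d. c \<alpha> * (\<Prod>i\<in>I. x i v ^ \<alpha> i)) =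
      (\<Sum>\<alpha>\<in>exponents I d'. (if \<alpha> \<in> exponents I d then c \<alpha> else 0) * (\<Prod>i\<in>I. x i v ^ \<alpha> i))" for v
    by (rule sum.mono_neutral_cong_left)
      (use sub finite_exponents[OF assms(1)] in auto)
  with c show ?thesis
    unfolding polynomial_functions_le_def by auto
qed

lemma polynomial_functions_cong:
  assumes "g \<in> polynomial_functions x I X" "\<And>v. v \<in> X \<Longrightarrow> f v = g v"
  shows "f \<in> polynomial_functions x I X"
  using assms by (simp add: polynomial_functions_le_def)

lemma polynomial_functions_monomial:
  assumes "finite I"
  shows "(\<lambda>v. \<Prod>i\<in>I. x i v ^ \<alpha> i) \<in> polynomial_functions x I X"
proof -
  define \<beta> where "\<beta> = (\<lambda>i. if i \<in> I then \<alpha> i else 0)"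
  have b: "\<beta> \<in> exponents I (\<Sum>i\<in>I. \<beta> i)"
    by (auto simp: exponents_def \<beta>_def)
  have "(\<Prod>i\<in>I. x i v ^ \<alpha> i) =
      (\<Sum>\<gamma>\<in>exponents I (\<Sum>i\<in>I. \<beta> i). (if \<gamma> = \<beta> then 1 else 0) * (\<Prod>i\<in>I. x i v ^ \<gamma> i))" for v
  proof -
    have "(\<Sum>\<gamma>\<in>exponents I (\<Sum>i\<in>I. \<beta> i). (if \<gamma> = \<beta> then 1 else 0) * (\<Prod>i\<in>I. x i v ^ \<gamma> i)) =
        (\<Sum>\<gamma>\<in>exponents I (\<Sum>i\<in>I. \<beta> i). if \<gamma> = \<beta> then (\<Prod>i\<in>I. x i v ^ \<gamma> i) else 0)"
      by (intro sum.cong) auto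
    also have "\<dots> = (\<Prod>i\<in>I. x i v ^ \<beta> i)"
      using b by (simp add: finite_exponents[OF assms] sum.delta)
    also have "\<dots> = (\<Prod>i\<in>I. x i v ^ \<alpha> i)"
      by (intro prod.cong) (auto simp: \<beta>_def)
    finally show ?thesis by simp
  qed
  then show ?thesis
    unfolding polynomial_functions_le_def by auto
qed

lemma polynomial_functions_add:
  assumes "finite I" "f \<in> polynomial_functions x I X" "g \<in> polynomial_functions x I X"
  shows "(\<lambda>v. f v + g v) \<in> polynomial_functions x I X"
proof -
  obtain d e where "f \<in> polynomial_functions_le x I X d" "g \<in> polynomial_functions_le x I X e"
    using assms by auto
  then have "f \<in> polynomial_functions_le x I X (max d e)" "g \<in> polynomial_functions_le x I X (max d e)"
    using polynomial_functions_le_mono[OF assms(1)] by (meson max.cobounded1 max.cobounded2)+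
  then obtain a b where
    "\<forall>v\<in>X. f v = (\<Sum>\<alpha>\<in>exponents I (max d e). a \<alpha> * (\<Prod>i\<in>I. x i v ^ \<alpha> i))"
    "\<forall>v\<in>X. g v = (\<Sum>\<alpha>\<in>exponents I (max d e). b \<alpha> * (\<Prod>i\<in>I. x i v ^ \<alpha> i))"
    unfolding polynomial_functions_le_def by blast
  then have "\<forall>v\<in>X. f v + g v =
      (\<Sum>\<alpha>\<in>exponents I (max d e). (a \<alpha> + b \<alpha>) * (\<Prod>i\<in>I. x i v ^ \<alpha> i))"
    by (simp add: distrib_right sum.distrib)
  then have "(\<lambda>v. f v + g v) \<in> polynomial_functions_le x I X (max d e)"
    unfolding polynomial_functions_le_def by (intro CollectI exI[of _ "\<lambda>\<alpha>. a \<alpha> + b \<alpha>"])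
  then show ?thesis by blast
qed

lemma polynomial_functions_scale:
  assumes "f \<in> polynomial_functions x I X"
  shows "(\<lambda>v. a * f v) \<in> polynomial_functions x I X"
proof -
  obtain d c where "\<forall>v\<in>X. f v = (\<Sum>\<alpha>\<in>exponents I d. c \<alpha> * (\<Prod>i\<in>I. x i v ^ \<alpha> i))"
    using assms unfolding polynomial_functions_le_def by blast
  then have "\<forall>v\<in>X. a * f v = (\<Sum>\<alpha>\<in>exponents I d. (a * c \<alpha>) * (\<Prod>i\<in>I. x i v ^ \<alpha> i))"
    by (simp add: sum_distrib_left mult.assoc)
  then have "(\<lambda>v. a * f v) \<in> polynomial_functions_le x I X d"
    unfolding polynomial_functions_le_def by (intro CollectI exI[of _ "\<lambda>\<alpha>. a * c \<alpha>"])
  then show ?thesis by blast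
qed

lemma polynomial_functions_const:
  assumes "finite I"
  shows "(\<lambda>v. a) \<in> polynomial_functions x I X"
  using polynomial_functions_scale[OF polynomial_functions_monomial[OF assms, of x "\<lambda>_. 0" X], of a]
  by simp

lemma polynomial_functions_coordinate:
  assumes "finite I" "i \<in> I"
  shows "x i \<in> polynomial_functions x I X"
proof (rule polynomial_functions_cong)
  show "(\<lambda>v. \<Prod>j\<in>I. x j v ^ (if j = i then 1 else 0)) \<in> polynomial_functions x I X"
    by (rule polynomial_functions_monomial[OF assms(1)])
  have "x j v ^ (if j = i then 1 else 0) = (if j = i then x j v else 1)" for v j
    by simp
  then show "x i v = (\<Prod>j\<in>I. x j v ^ (if j = i then 1 else 0))" for v
    using assms by (simp add: prod.delta)
qed

lemma polynomial_functions_sum: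
  assumes "finite I" "\<And>a. a \<in> A \<Longrightarrow> f a \<in> polynomial_functions x I X"
  shows "(\<lambda>v. \<Sum>a\<in>A. f a v) \<in> polynomial_functions x I X"
proof (cases "finite A")
  case True
  then show ?thesis
    using assms(2)
  proof (induction A)
    case empty
    show ?case using polynomial_functions_const[OF assms(1), of 0] by simp
  next
    case (insert a A)
    then show ?case
      using polynomial_functions_add[OF assms(1), of "f a" x X "\<lambda>v. \<Sum>a\<in>A. f a v"] by simp
  qed
next
  case False
  then show ?thesis using polynomial_functions_const[OF assms(1), of 0] by simp
qed

lemma polynomial_functions_mult:
  assumes "finite I" "f \<in> polynomial_functions x I X" "g \<in> polynomial_functions x I X"
  shows "(\<lambda>v. f v * g v) \<in> polynomial_functions x I X"
proof -
  obtain d a where f: "\<forall>v\<in>X. f v = (\<Sum>\<alpha>\<in>exponents I d. a \<alpha> * (\<Prod>i\<in>I. x i v ^ \<alpha> i))"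
    using assms(2) unfolding polynomial_functions_le_def by blast
  obtain e b where g: "\<forall>v\<in>X. g v = (\<Sum>\<alpha>\<in>exponents I e. b \<alpha> * (\<Prod>i\<in>I. x i v ^ \<alpha> i))"
    using assms(3) unfolding polynomial_functions_le_def by blast
  show ?thesis
  proof (rule polynomial_functions_cong)
    show "(\<lambda>v. \<Sum>\<alpha>\<in>exponents I d. \<Sum>\<beta>\<in>exponents I e.
        (a \<alpha> * b \<beta>) * (\<Prod>i\<in>I. x i v ^ (\<alpha> i + \<beta> i))) \<in> polynomial_functions x I X"
      by (intro polynomial_functions_sum polynomial_functions_scale
          polynomial_functions_monomial assms(1))
    show "f v * g v = (\<Sum>\<alpha>\<in>exponents I d. \<Sum>\<beta>\<in>exponents I e.
        (a \<alpha> * b \<beta>) * (\<Prod>i\<in>I. x i v ^ (\<alpha> i + \<beta> i)))" if "v \<in> X" for v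
      using f g that by (simp add: sum_product power_add prod.distrib mult_ac)
  qed
qed

lemma polynomial_functions_prod:
  assumes "finite I" "\<And>a. a \<in> A \<Longrightarrow> f a \<in> polynomial_functions x I X"
  shows "(\<lambda>v. \<Prod>a\<in>A. f a v) \<in> polynomial_functions x I X"
proof (cases "finite A")
  case True
  then show ?thesis
    using assms(2)
  proof (induction A)
    case empty
    show ?case using polynomial_functions_const[OF assms(1), of 1] by simp
  next
    case (insert a A)
    then show ?case
      using polynomial_functions_mult[OF assms(1), of "f a" x X "\<lambda>v. \<Prod>a\<in>A. f a v"] by simp
  qed
next
  case False
  then show ?thesis using polynomial_functions_const[OF assms(1), of 1] by simp
qed

lemma adj_mat_entry_polynomial:
  fixes i j n :: nat
  assumes "i < n" "j < n"
  shows "(\<lambda>A. adj_mat A $$ (i, j)) \<in> matrix_polynomials n"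
proof -
  let ?S = "{p. p permutes {0..<n - 1}}"
  let ?r = "\<lambda>k l. if k < l then k else Suc k"
  let ?P = "\<lambda>A. (-1) ^ (i + j) * (\<Sum>p\<in>?S. signof p * (\<Prod>k = 0..<n - 1. A $$ (?r k j, ?r (p k) i)))"
  have *: "?P \<in> matrix_polynomials n"
    unfolding matrix_polynomials_def
  proof (intro polynomial_functions_scale polynomial_functions_sum polynomial_functions_prod)
    fix p k
    assume "p \<in> ?S" "k \<in> {0..<n - 1}"
    then have "k < n - 1" "p k < n - 1"
      using permutes_in_image[of p "{0..<n - 1}" k] by auto
    then show "(\<lambda>A. A $$ (?r k j, ?r (p k) i)) \<in>
        polynomial_functions (\<lambda>ij A. A $$ ij) ({..<n} \<times> {..<n}) (carrier_mat n n)"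
      using assms
      by (intro polynomial_functions_coordinate) auto
  qed auto
  have "adj_mat A $$ (i, j) = ?P A" if A: "A \<in> carrier_mat n n" for A
  proof -
    have D: "mat_delete A j i \<in> carrier_mat (n - 1) (n - 1)"
      by (rule mat_delete_carrier[OF A])
    have "mat_delete A j i $$ (k, p k) = A $$ (?r k j, ?r (p k) i)"
      if "p \<in> ?S" "k \<in> {0..<n - 1}" for p k
    proof -
      have "k < n - 1" "p k < n - 1"
        using that permutes_in_image[of p "{0..<n - 1}" k] by auto
      then show ?thesis using A by (auto simp: mat_delete_def)
    qed
    then have "det (mat_delete A j i) = 
        (\<Sum>p\<in>?S. signof p * (\<Prod>k = 0..<n - 1. A $$ (?r k j, ?r (p k) i)))"
      unfolding det_def'[OF D] by (intro sum.cong prod.cong arg_cong2[of _ _ _ _ "(*)"]) auto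
    then show ?thesis
      using A assms by (simp add: adj_mat_def cofactor_def add.commute)
  qed
  then show ?thesis
    unfolding matrix_polynomials_def
    by (rule polynomial_functions_cong[OF *[unfolded matrix_polynomials_def]])
qed

lemma regular_functions_polynomial:
  assumes "P \<in> matrix_polynomials n" 
  shows "P \<in> regular_functions n G"
  unfolding regular_functions_def using assms by (auto intro!: bexI[of _ P] exI[of _ 0])

lemma regular_functions_const: "(\<lambda>A. a) \<in> regular_functions n G"
  by (rule regular_functions_polynomial)
    (simp add: matrix_polynomials_def polynomial_functions_const[simplified])

lemma regular_functions_entry:
  assumes "i < n" "j < n"
  shows "(\<lambda>A. A $$ (i, j)) \<in> regular_functions n G"
  by (rule regular_functions_polynomial, unfold matrix_polynomials_def,
      rule polynomial_functions_coordinate) (use assms in auto)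

lemma regular_functions_mult:
  assumes "f \<in> regular_functions n G" "g \<in> regular_functions n G"
  shows "(\<lambda>A. f A * g A) \<in> regular_functions n G"
proof -
  obtain P k where P: "P \<in> matrix_polynomials n" "\<forall>A\<in>G. f A = P A / det A ^ k"
    using assms(1) unfolding regular_functions_def by blast
  obtain Q l where Q: "Q \<in> matrix_polynomials n" "\<forall>A\<in>G. g A = Q A / det A ^ l"
    using assms(2) unfolding regular_functions_def by blast
  have "(\<lambda>A. P A * Q A) \<in> matrix_polynomials n"
    using P(1) Q(1) unfolding matrix_polynomials_def
    by (intro polynomial_functions_mult) auto
  moreover have "\<forall>A\<in>G. f A * g A = P A * Q A / det A ^ (k + l)"
    using P(2) Q(2) by (simp add: power_add)
  ultimately show ?thesis
    unfolding regular_functions_def by (intro CollectI bexI exI)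
qed

lemma regular_functions_prod:
  assumes "\<And>a. a \<in> A \<Longrightarrow> f a \<in> regular_functions n G"
  shows "(\<lambda>B. \<Prod>a\<in>A. f a B) \<in> regular_functions n G"
  using assms
proof (induction A rule: infinite_finite_induct)
  case (insert a A)
  then show ?case
    using regular_functions_mult[of "f a" n G "\<lambda>B. \<Prod>a\<in>A. f a B"] by simp
qed (simp_all add: regular_functions_const)

section \<open>General linear groups\<close>

lemma group_GL: "Group.group (GL n :: 'k::field mat monoid)"
  by (intro monoid.units_group ring.is_monoid ring_mat)

lemma GL_mult [simp]: "A \<otimes>\<^bsub>GL n\<^esub> B = A * B"
  by (simp add: units_of_mult ring_mat_def)

lemma GL_one [simp]: "\<one>\<^bsub>GL n\<^esub> = 1\<^sub>m n"
  by (simp add: units_of_one ring_mat_def)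

lemma carrier_GL_iff:
  "A \<in> carrier (GL n) \<longleftrightarrow>
     A \<in> carrier_mat n n \<and> (\<exists>B\<in>carrier_mat n n. B * A = 1\<^sub>m n \<and> A * B = 1\<^sub>m n)"
  by (auto simp: units_of_def Units_def ring_mat_def)

lemma GL_inv:
  assumes "A \<in> carrier (GL n)"
  shows "inv\<^bsub>GL n\<^esub> A \<in> carrier_mat n n"
    and "A * inv\<^bsub>GL n\<^esub> A = 1\<^sub>m n"
    and "inv\<^bsub>GL n\<^esub> A * A = 1\<^sub>m n"
proof -
  interpret Group.group "GL n :: 'a mat monoid" by (rule group_GL)
  show "inv\<^bsub>GL n\<^esub> A \<in> carrier_mat n n"
    using inv_closed[OF assms] carrier_GL_iff by blast
  show "A * inv\<^bsub>GL n\<^esub> A = 1\<^sub>m n" "inv\<^bsub>GL n\<^esub> A * A = 1\<^sub>m n"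
    using r_inv[OF assms] l_inv[OF assms] by simp_all
qed

lemma regular_functions_inv_entry:
  fixes G :: "'k::field mat set"
  assumes "G \<subseteq> carrier (GL n)" "i < n" "j < n"
  shows "(\<lambda>A. (inv\<^bsub>GL n\<^esub> A) $$ (i, j)) \<in> regular_functions n G"
proof -
  have "(inv\<^bsub>GL n\<^esub> A) $$ (i, j) = adj_mat A $$ (i, j) / det A ^ 1" if "A \<in> G" for A :: "'k mat"
  proof -
    let ?B = "inv\<^bsub>GL n\<^esub> A"
    have AG: "A \<in> carrier (GL n)" using that assms by auto
    then have A: "A \<in> carrier_mat n n" by (simp add: carrier_GL_iff)
    note B = GL_inv[OF AG]
    have d: "det A \<noteq> 0"
      using det_mult[OF A B(1)] B(2) by auto
    have "adj_mat A = adj_mat A * (A * ?B)"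
      using B adj_mat(1)[OF A] by simp
    also have "\<dots> = adj_mat A * A * ?B"
      using A B(1) adj_mat(1)[OF A] by (simp add: assoc_mult_mat)
    also have "\<dots> = det A \<cdot>\<^sub>m ?B"
      using adj_mat(3)[OF A] B(1) by (metis left_mult_one_mat mult_smult_assoc_mat one_carrier_mat)
    finally have "adj_mat A = det A \<cdot>\<^sub>m ?B" .
    then show ?thesis
      using B(1) assms(2,3) d by simp
  qed
  then show ?thesis
    unfolding regular_functions_def using adj_mat_entry_polynomial[OF assms(2,3)]
    by (intro CollectI bexI exI ballI)
qed

section \<open>Elements of finite order in a torus\<close>

lemma prime_order_power_eq_1_iff:
  fixes z :: "'k::field"
  assumes "prime q" "z ^ q = 1" "z \<noteq> 1"
  shows "z ^ k = 1 \<longleftrightarrow> q dvd k"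
proof
  assume k: "z ^ k = 1"
  show "q dvd k"
  proof (rule ccontr)
    assume "\<not> q dvd k"
    then have "coprime k q"
      using assms(1) prime_imp_coprime coprime_commute by blast
    have "k \<noteq> 0"
      using \<open>\<not> q dvd k\<close> by (metis dvd_0_right)
    then obtain x y where "k * x = q * y + 1"
      using bezout_nat[of k q] \<open>coprime k q\<close> by auto
    then have "z ^ (k * x) = z ^ (q * y) * z"
      by simp
    then have "z = 1"
      by (simp add: power_mult k assms(2))
    with assms(3) show False by simp
  qed
next
  assume "q dvd k"
  then show "z ^ k = 1"
    using assms(2) by (auto simp: dvd_def power_mult)
qed

lemma sum_powers_root_of_unity:
  fixes z :: "'k::field"
  assumes "z ^ q = 1" "z \<noteq> 1"
  shows "(\<Sum>i<q. z ^ i) = 0"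
  using assms by (simp add: geometric_sum)

lemma exists_root_of_unity:
  assumes "prime q" "of_nat q \<noteq> (0 :: 'k::alg_closed_field)"
  obtains z :: "'k::alg_closed_field" where "z ^ q = 1" "z \<noteq> 1"
proof -
  have q: "q \<ge> 2" using assms(1) by (rule prime_ge_2_nat)
  obtain z :: 'k where z: "(\<Sum>i\<le>q - 1. 1 * z ^ i) = 0"
    using alg_closed[of "q - 1" "\<lambda>_. 1 :: 'k"] q by auto
  have *: "(\<Sum>i<q. z ^ i) = 0"
    using z q by (simp add: lessThan_Suc_atMost[symmetric])
  have "z \<noteq> 1"
    using * assms(2) by auto
  moreover have "z ^ q = 1"
    using * \<open>z \<noteq> 1\<close> by (simp add: geometric_sum)
  ultimately show ?thesis using that by blast
qed

lemma exists_large_invertible_prime: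
  obtains q where "prime q" "q > N" "of_nat q \<noteq> (0 :: 'k::field)"
proof -
  obtain q where q: "prime q" "q > max N CHAR('k)"
    using bigger_prime by blast
  have "\<not> CHAR('k) dvd q"
  proof
    assume "CHAR('k) dvd q"
    then have "CHAR('k) = 1 \<or> CHAR('k) = q"
      using q(1) unfolding prime_nat_iff by blast
    then have *: "CHAR('k) = 1"
      using q(2) by simp
    have "of_nat 1 = (0 :: 'k)"
      unfolding *[symmetric] by (rule of_nat_CHAR)
    then show False by simp
  qed
  then show ?thesis
    using q that by (simp add: of_nat_eq_0_iff_char_dvd)
qed

lemma diag_in_diagonal_group:
  assumes "\<And>i. i < r \<Longrightarrow> d i \<noteq> (0 :: 'k::field)"
  shows "mat r r (\<lambda>(i, j). if i = j then d i else 0) \<in> diagonal_group r"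
proof -
  let ?D = "\<lambda>d. mat r r (\<lambda>(i, j). if i = j then d i else 0) :: 'k mat"
  have mult: "?D a * ?D b = ?D (\<lambda>i. a i * b i)" for a b
    by (rule eq_matI) (auto simp: scalar_prod_def if_distrib[of "(*) _"] sum.delta cong: if_cong)
  have one: "?D (\<lambda>i. x i * y i) = 1\<^sub>m r" if "\<And>i. i < r \<Longrightarrow> x i * y i = 1" for x y
    by (rule eq_matI) (use that in auto)
  show ?thesis
    unfolding diagonal_group_def carrier_GL_iff
    using assms
    by (auto simp: diagonal_mat_def mult intro!: bexI[of _ "?D (\<lambda>i. inverse (d i))"] one)
qed

lemma torus_element_of_prime_order:
  fixes T :: "'k::alg_closed_field mat set"
  assumes "torus n T" "T \<noteq> {1\<^sub>m n}" "prime q" "of_nat q \<noteq> (0 :: 'k)"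
  obtains t where "t \<in> T" "t ^\<^sub>m q = 1\<^sub>m n" "t \<noteq> 1\<^sub>m n"
proof -
  have sub: "subgroup T (GL n)"
    using assms(1) by (simp add: torus_def linear_algebraic_group_def)
  obtain r where "algebraic_group_iso n T r (diagonal_group r)"
    using assms(1) unfolding torus_def by blast
  then obtain \<phi> \<psi> where
    \<phi>_hom: "\<phi> \<in> algebraic_group_homs n T r (diagonal_group r)" and
    \<psi>_hom: "\<psi> \<in> algebraic_group_homs r (diagonal_group r) n T" and
    inverse: "\<forall>A\<in>T. \<psi> (\<phi> A) = A" "\<forall>B\<in>diagonal_group r. \<phi> (\<psi> B) = B"
    unfolding algebraic_group_iso_def by blast
  have \<phi>: "\<phi> \<in> hom (GL n\<lparr>carrier := T\<rparr>) (GL r\<lparr>carrier := diagonal_group r\<rparr>)"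
    using \<phi>_hom by (simp add: algebraic_group_homs_def)
  have \<psi>: "\<psi> \<in> hom (GL r\<lparr>carrier := diagonal_group r\<rparr>) (GL n\<lparr>carrier := T\<rparr>)"
    using \<psi>_hom by (simp add: algebraic_group_homs_def)
  have T_mat: "A \<in> carrier_mat n n" if "A \<in> T" for A
    using that subgroup.subset[OF sub] carrier_GL_iff by blast
  have \<psi>_in: "\<psi> B \<in> T" if "B \<in> diagonal_group r" for B
    using \<psi> that by (auto simp: hom_def)
  have \<psi>_mult: "\<psi> (B * C) = \<psi> B * \<psi> C" if "B \<in> diagonal_group r" "C \<in> diagonal_group r" for B C
    using hom_mult[OF \<psi>, of B C] that by simp
  define D where "D z = mat r r (\<lambda>(i, j). if i = j then z else 0)" for z :: 'k
  have D_in: "D z \<in> diagonal_group r" if "z \<noteq> 0" for z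
    unfolding D_def by (rule diag_in_diagonal_group) (use that in auto)
  have D_mult: "D z * D w = D (z * w)" for z w
    unfolding D_def
    by (rule eq_matI) (auto simp: scalar_prod_def if_distrib[of "(*) _"] sum.delta cong: if_cong)
  have "1\<^sub>m n \<in> T"
    using subgroup.one_closed[OF sub] by simp
  have "r > 0"
  proof (rule ccontr)
    assume "\<not> r > 0"
    then have eq: "B = C" if "B \<in> diagonal_group r" "C \<in> diagonal_group r" for B C
      using that by (intro eq_matI) (auto simp: diagonal_group_def carrier_GL_iff)
    have \<phi>_in: "\<phi> A \<in> diagonal_group r" if "A \<in> T" for A
      using \<phi> that by (auto simp: hom_def)
    have "A = 1\<^sub>m n" if "A \<in> T" for A
    proof -
      have "\<psi> (\<phi> A) = \<psi> (\<phi> (1\<^sub>m n))"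
        by (rule arg_cong[OF eq]) (intro \<phi>_in that \<open>1\<^sub>m n \<in> T\<close>)+
      then show ?thesis
        using inverse(1) that \<open>1\<^sub>m n \<in> T\<close> by simp
    qed
    then show False
      using assms(2) \<open>1\<^sub>m n \<in> T\<close> by blast
  qed
  have \<psi>_one: "\<psi> (D 1) = 1\<^sub>m n"
  proof -
    have "\<psi> (D 1) \<in> carrier (GL n)"
      using \<psi>_in[OF D_in] subgroup.subset[OF sub] by auto
    moreover have "\<psi> (D 1) * \<psi> (D 1) = \<psi> (D 1)"
      using \<psi>_mult[OF D_in D_in, of 1 1] D_mult[of 1 1] by simp
    ultimately show ?thesis
      using Group.group.l_cancel_one[OF group_GL, of "\<psi> (D 1)" n "\<psi> (D 1)"]
      unfolding GL_mult GL_one by blast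
  qed
  obtain z :: 'k where z: "z ^ q = 1" "z \<noteq> 1"
    using exists_root_of_unity[OF assms(3,4)] .
  have "z \<noteq> 0"
    using z(1) prime_gt_0_nat[OF assms(3)] by (auto simp: power_0_left)
  have power: "\<psi> (D z) ^\<^sub>m k = \<psi> (D (z ^ k))" for k
  proof (induction k)
    case 0
    show ?case
      using T_mat[OF \<psi>_in[OF D_in[OF \<open>z \<noteq> 0\<close>]]] by (simp add: \<psi>_one)
  next
    case (Suc k)
    then show ?case
      using \<psi>_mult[OF D_in D_in, of "z ^ k" z] \<open>z \<noteq> 0\<close> by (simp add: D_mult mult.commute)
  qed
  show ?thesis
  proof
    show "\<psi> (D z) \<in> T"
      by (intro \<psi>_in D_in \<open>z \<noteq> 0\<close>)
    show "\<psi> (D z) ^\<^sub>m q = 1\<^sub>m n"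
      by (simp add: power z \<psi>_one)
    show "\<psi> (D z) \<noteq> 1\<^sub>m n"
    proof
      assume "\<psi> (D z) = 1\<^sub>m n"
      then have "\<phi> (\<psi> (D z)) = \<phi> (\<psi> (D 1))"
        by (simp add: \<psi>_one)
      then have "D z = D 1"
        using inverse(2) D_in \<open>z \<noteq> 0\<close> by simp
      then have "D z $$ (0, 0) = D 1 $$ (0, 0)"
        by simp
      then show False
        using \<open>r > 0\<close> z(2) by (simp add: D_def)
    qed
  qed
qed

text \<open>
  The matrix \<open>E \<mu> = (\<Sum>k<q. \<mu> ^ k \<cdot> t ^ k)\<close> is \<open>q\<close> times the projection onto the eigenspace
  of \<open>t\<close> for the eigenvalue \<open>1 / \<mu>\<close>; if only \<open>E 1\<close> were nonzero, then \<open>t\<close> would be the identity.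
  A column and a row of \<open>E \<mu>\<close> through a nonzero entry provide the two eigenvectors.
\<close>

lemma dual_eigenvectors:
  fixes t :: "'k::alg_closed_field mat"
  assumes t: "t \<in> carrier_mat n n" and tq: "t ^\<^sub>m q = 1\<^sub>m n" and "t \<noteq> 1\<^sub>m n"
    and "prime q" "of_nat q \<noteq> (0 :: 'k)"
  obtains \<kappa> e \<epsilon> where "\<kappa> ^ q = 1" "\<kappa> \<noteq> 1"
    "\<forall>a<n. (\<Sum>b<n. t $$ (a, b) * e b) = \<kappa> * e a"
    "\<forall>b<n. (\<Sum>a<n. \<epsilon> a * t $$ (a, b)) = \<kappa> * \<epsilon> b"
    "(\<Sum>b<n. \<epsilon> b * e b) \<noteq> 0"
proof -
  define p where "p k a b = (t ^\<^sub>m k) $$ (a, b)" for k a b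
  have p_left: "(\<Sum>c<n. t $$ (a, c) * p k c b) = p (Suc k) a b" if "a < n" "b < n" for a b k
  proof -
    have "t ^\<^sub>m Suc k = t * t ^\<^sub>m k"
      using t by (induction k) (auto simp: assoc_mult_mat[of _ n n _ n _ n])
    then show ?thesis
      using that t by (simp add: p_def scalar_prod_def atLeast0LessThan)
  qed
  have p_right: "(\<Sum>c<n. p k a c * t $$ (c, b)) = p (Suc k) a b" if "a < n" "b < n" for a b k
    using that t by (simp add: p_def scalar_prod_def atLeast0LessThan)
  have p0: "p 0 a b = (if a = b then 1 else 0)" "p q a b = p 0 a b" if "a < n" "b < n" for a b
    using that t tq by (auto simp: p_def)
  define E where "E \<mu> a b = (\<Sum>k<q. \<mu> ^ k * p k a b)" for \<mu> a b
  have shift: "\<mu> * (\<Sum>k<q. \<mu> ^ k * p (Suc k) a b) = E \<mu> a b"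
    if "\<mu> ^ q = 1" "a < n" "b < n" for \<mu> a b
  proof -
    have "\<mu> * (\<Sum>k<q. \<mu> ^ k * p (Suc k) a b) + p 0 a b = (\<Sum>k<Suc q. \<mu> ^ k * p k a b)"
      by (simp add: sum.lessThan_Suc_shift sum_distrib_left mult_ac del: sum.lessThan_Suc)
    also have "\<dots> = E \<mu> a b + p 0 a b"
      using that p0 by (simp add: E_def)
    finally show ?thesis by simp
  qed
  have E_left: "\<mu> * (\<Sum>c<n. t $$ (a, c) * E \<mu> c b) = E \<mu> a b"
    if "\<mu> ^ q = 1" "a < n" "b < n" for \<mu> a b
  proof -
    have "(\<Sum>c<n. t $$ (a, c) * E \<mu> c b) = (\<Sum>k<q. \<mu> ^ k * (\<Sum>c<n. t $$ (a, c) * p k c b))"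
      unfolding E_def sum_distrib_left by (subst sum.swap) (simp add: mult_ac)
    also have "\<dots> = (\<Sum>k<q. \<mu> ^ k * p (Suc k) a b)"
      using that by (simp add: p_left)
    finally show ?thesis using shift that by simp
  qed
  have E_right: "\<mu> * (\<Sum>c<n. E \<mu> a c * t $$ (c, b)) = E \<mu> a b"
    if "\<mu> ^ q = 1" "a < n" "b < n" for \<mu> a b
  proof -
    have "(\<Sum>c<n. E \<mu> a c * t $$ (c, b)) = (\<Sum>k<q. \<mu> ^ k * (\<Sum>c<n. p k a c * t $$ (c, b)))"
      unfolding E_def sum_distrib_left sum_distrib_right by (subst sum.swap) (simp add: mult_ac)
    also have "\<dots> = (\<Sum>k<q. \<mu> ^ k * p (Suc k) a b)"
      using that by (simp add: p_right)
    finally show ?thesis using shift that by simp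
  qed
  have E_idem: "(\<Sum>c<n. E \<mu> a c * E \<mu> c b) = of_nat q * E \<mu> a b"
    if \<mu>: "\<mu> ^ q = 1" and ab: "a < n" "b < n" for \<mu> a b
  proof -
    have pE: "\<mu> ^ k * (\<Sum>c<n. p k a c * E \<mu> c b) = E \<mu> a b" for k
    proof (induction k)
      case 0
      have "(\<Sum>c<n. p 0 a c * E \<mu> c b) = (\<Sum>c<n. if a = c then E \<mu> c b else 0)"
        using ab by (intro sum.cong) (auto simp: p0)
      then show ?case using ab by simp
    next
      case (Suc k)
      have "(\<Sum>c<n. p (Suc k) a c * E \<mu> c b) =
          (\<Sum>c<n. \<Sum>d<n. p k a d * t $$ (d, c) * E \<mu> c b)"
        using ab by (intro sum.cong) (auto simp: p_right[symmetric] sum_distrib_right)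
      also have "\<dots> = (\<Sum>d<n. p k a d * (\<Sum>c<n. t $$ (d, c) * E \<mu> c b))"
        by (subst sum.swap) (simp add: sum_distrib_left mult_ac)
      finally have "\<mu> * (\<Sum>c<n. p (Suc k) a c * E \<mu> c b) =
          (\<Sum>d<n. p k a d * (\<mu> * (\<Sum>c<n. t $$ (d, c) * E \<mu> c b)))"
        by (simp add: sum_distrib_left mult_ac)
      also have "\<dots> = (\<Sum>d<n. p k a d * E \<mu> d b)"
        using ab \<mu> by (simp add: E_left)
      finally show ?case
        using Suc by (simp only: power_Suc2 mult.assoc)
    qed
    have "(\<Sum>c<n. E \<mu> a c * E \<mu> c b) = (\<Sum>k<q. \<mu> ^ k * (\<Sum>c<n. p k a c * E \<mu> c b))"
      unfolding E_def[of \<mu> a] sum_distrib_left sum_distrib_right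
      by (subst sum.swap) (simp add: mult_ac)
    then show ?thesis by (simp add: pE)
  qed
  have "q > 0" using assms(4) by (rule prime_gt_0_nat)
  obtain z :: 'k where z: "z ^ q = 1" "z \<noteq> 1"
    using exists_root_of_unity[OF assms(4,5)] .
  have zj: "(z ^ j) ^ q = 1" for j
    using z by (metis power_mult mult.commute power_one)
  have "\<exists>j<q. z ^ j \<noteq> 1 \<and> (\<exists>a<n. \<exists>b<n. E (z ^ j) a b \<noteq> 0)"
  proof (rule ccontr)
    assume "\<not> ?thesis"
    then have zero: "E (z ^ j) a b = 0" if "0 < j" "j < q" "a < n" "b < n" for j a b
      using that prime_order_power_eq_1_iff[OF assms(4) z, of j] by (auto dest: dvd_imp_le)
    have E1: "E 1 a b = of_nat q * p 0 a b" if "a < n" "b < n" for a b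
    proof -
      have "E 1 a b = (\<Sum>j<q. if j = 0 then E 1 a b else 0)"
        using \<open>q > 0\<close> by simp
      also have "\<dots> = (\<Sum>j<q. E (z ^ j) a b)"
        using that zero by (intro sum.cong) auto
      also have "\<dots> = (\<Sum>k<q. (\<Sum>j<q. (z ^ k) ^ j) * p k a b)"
        unfolding E_def sum_distrib_right
        by (subst sum.swap) (simp add: power_mult[symmetric] mult.commute[of _ "_ :: nat"])
      also have "\<dots> = (\<Sum>k<q. if k = 0 then of_nat q * p 0 a b else 0)"
      proof (intro sum.cong refl)
        fix k assume k: "k \<in> {..<q}"
        show "(\<Sum>j<q. (z ^ k) ^ j) * p k a b = (if k = 0 then of_nat q * p 0 a b else 0)"
        proof (cases "k = 0")
          case False
          then have "z ^ k \<noteq> 1"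
            using k prime_order_power_eq_1_iff[OF assms(4) z, of k] by (auto dest: dvd_imp_le)
          then show ?thesis
            using sum_powers_root_of_unity[OF zj] False by simp
        qed auto
      qed
      also have "\<dots> = of_nat q * p 0 a b"
        using \<open>q > 0\<close> by simp
      finally show ?thesis .
    qed
    have "t $$ (a, b) = 1\<^sub>m n $$ (a, b)" if ab: "a < n" "b < n" for a b
    proof -
      have "of_nat q * p 0 a b = (\<Sum>c<n. t $$ (a, c) * (of_nat q * p 0 c b))"
        using E_left[of 1 a b] ab by (simp add: E1)
      also have "\<dots> = of_nat q * (\<Sum>c<n. t $$ (a, c) * p 0 c b)"
        by (simp add: sum_distrib_left mult_ac)
      also have "(\<Sum>c<n. t $$ (a, c) * p 0 c b) = t $$ (a, b)"
        using p_left[OF ab, of 0] t by (simp add: p_def)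
      finally show ?thesis
        using assms(5) ab by (simp add: p0)
    qed
    then have "t = 1\<^sub>m n"
      using t by (intro eq_matI) auto
    with assms(3) show False ..
  qed
  then obtain j a b where j: "z ^ j \<noteq> 1" and ab: "a < n" "b < n" "E (z ^ j) a b \<noteq> 0"
    by blast
  define \<mu> where "\<mu> = z ^ j"
  have \<mu>: "\<mu> ^ q = 1" "\<mu> \<noteq> 1"
    using zj[of j] j by (simp_all add: \<mu>_def)
  then have "\<mu> \<noteq> 0"
    using \<open>q > 0\<close> by (auto simp: power_0_left)
  show ?thesis
  proof
    show "(1 / \<mu>) ^ q = 1" "1 / \<mu> \<noteq> 1"
      using \<mu> by (auto simp: power_one_over)
    show "\<forall>c<n. (\<Sum>d<n. t $$ (c, d) * E \<mu> d b) = 1 / \<mu> * E \<mu> c b"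
      using E_left[OF \<mu>(1) _ ab(2)] \<open>\<mu> \<noteq> 0\<close> by (simp add: field_simps)
    show "\<forall>d<n. (\<Sum>c<n. E \<mu> a c * t $$ (c, d)) = 1 / \<mu> * E \<mu> a d"
      using E_right[OF \<mu>(1) ab(1)] \<open>\<mu> \<noteq> 0\<close> by (simp add: field_simps)
    show "(\<Sum>c<n. E \<mu> a c * E \<mu> c b) \<noteq> 0"
      using E_idem[OF \<mu>(1) ab(1,2)] assms(5) ab(3) by (simp add: \<mu>_def)
  qed
qed

section \<open>Vanishing of invariants of low degree\<close>

text \<open>
  Averaging over the cyclic group generated by the diagonal matrix with entries \<open>\<kappa> ^ w i\<close> kills
  every monomial whose weight is not divisible by \<open>q\<close>, so only the constant term survives.
\<close>

lemma cyclic_invariant_vanishes: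
  fixes f :: "'k::field vec \<Rightarrow> 'k"
  assumes f: "f \<in> vector_polynomials_le m d" and f0: "f (0\<^sub>v m) = 0"
    and v: "v \<in> carrier_vec m"
    and q: "prime q" "of_nat q \<noteq> (0 :: 'k)" and \<kappa>: "\<kappa> ^ q = 1" "\<kappa> \<noteq> 1"
    and inv: "\<And>k. f (vec m (\<lambda>i. \<kappa> ^ (k * w i) * v $ i)) = f v"
    and weight: "\<And>\<gamma>. \<gamma> \<in> exponents {..<m} d \<Longrightarrow> q dvd (\<Sum>i<m. w i * \<gamma> i) \<Longrightarrow> \<gamma> = (\<lambda>_. 0)"
  shows "f v = 0"
proof -
  let ?E = "exponents {..<m} d"
  have fin: "finite ?E" by (simp add: finite_exponents)
  have zero_in: "(\<lambda>_. 0) \<in> ?E" by (simp add: exponents_def)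
  obtain c where c: "\<forall>v\<in>carrier_vec m. f v = (\<Sum>\<gamma>\<in>?E. c \<gamma> * (\<Prod>i<m. v $ i ^ \<gamma> i))"
    using f unfolding vector_polynomials_le_def polynomial_functions_le_def by blast
  have "f (0\<^sub>v m) = (\<Sum>\<gamma>\<in>?E. if \<gamma> = (\<lambda>_. 0) then c (\<lambda>_. 0) else 0)"
  proof -
    have "c \<gamma> * (\<Prod>i<m. 0\<^sub>v m $ i ^ \<gamma> i) = (if \<gamma> = (\<lambda>_. 0) then c (\<lambda>_. 0) else 0)"
      if "\<gamma> \<in> ?E" for \<gamma>
    proof (cases "\<gamma> = (\<lambda>_. 0)")
      case False
      then obtain i where "\<gamma> i \<noteq> 0"
        by blast
      moreover from this have "i < m"
        using \<open>\<gamma> \<in> ?E\<close> by (auto simp: exponents_def)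
      ultimately have "(\<Prod>i<m. 0\<^sub>v m $ i ^ \<gamma> i :: 'k) = 0"
        by (intro prod_zero) (auto intro!: bexI[of _ i])
      then show ?thesis using False by simp
    qed auto
    then show ?thesis using c by (simp cong: sum.cong)
  qed
  then have c0: "c (\<lambda>_. 0) = 0"
    using f0 fin zero_in by simp
  have orbit: "f v = (\<Sum>\<gamma>\<in>?E. c \<gamma> * (\<Prod>i<m. v $ i ^ \<gamma> i) * (\<kappa> ^ (\<Sum>i<m. w i * \<gamma> i)) ^ k)" for k
  proof -
    have "(\<Prod>i<m. (\<kappa> ^ (k * w i) * v $ i) ^ \<gamma> i) =
        (\<Prod>i<m. v $ i ^ \<gamma> i) * (\<kappa> ^ (\<Sum>i<m. w i * \<gamma> i)) ^ k" for \<gamma>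
      by (simp add: power_mult_distrib prod.distrib power_mult[symmetric] power_sum[symmetric]
          sum_distrib_left sum_distrib_right mult_ac)
    then show ?thesis
      using inv[of k, symmetric] c by (simp add: mult.assoc)
  qed
  have "of_nat q * f v = (\<Sum>k<q. f v)"
    by simp
  also have "\<dots> = (\<Sum>k<q. \<Sum>\<gamma>\<in>?E. c \<gamma> * (\<Prod>i<m. v $ i ^ \<gamma> i) * (\<kappa> ^ (\<Sum>i<m. w i * \<gamma> i)) ^ k)"
    by (intro sum.cong refl orbit)
  also have "\<dots> = (\<Sum>\<gamma>\<in>?E. c \<gamma> * (\<Prod>i<m. v $ i ^ \<gamma> i) *
      (\<Sum>k<q. (\<kappa> ^ (\<Sum>i<m. w i * \<gamma> i)) ^ k))"
    by (subst sum.swap) (simp add: sum_distrib_left)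
  also have "\<dots> = 0"
  proof (intro sum.neutral ballI)
    fix \<gamma> assume \<gamma>: "\<gamma> \<in> ?E"
    let ?z = "\<kappa> ^ (\<Sum>i<m. w i * \<gamma> i)"
    show "c \<gamma> * (\<Prod>i<m. v $ i ^ \<gamma> i) * (\<Sum>k<q. ?z ^ k) = 0"
    proof (cases "\<gamma> = (\<lambda>_. 0)")
      case True
      then show ?thesis by (simp add: c0)
    next
      case False
      then have "?z \<noteq> 1"
        using weight[OF \<gamma>] prime_order_power_eq_1_iff[OF q(1) \<kappa>] by blast
      moreover have "?z ^ q = 1"
        by (metis \<kappa>(1) mult.commute power_mult power_one)
      ultimately show ?thesis by (simp add: sum_powers_root_of_unity)
    qed
  qed
  finally show ?thesis using q(2) by simp
qed

lemma weight_of_low_degree_exponent: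
  fixes N q d m :: nat
  assumes "\<gamma> \<in> exponents {..<m} d" "d \<le> N" "N * N < q"
    and dvd: "q dvd (\<Sum>i<m. (if P i then 1 else (q - 1) * N) * \<gamma> i)"
  shows "\<gamma> = (\<lambda>_. 0)"
proof -
  define A where "A = (\<Sum>i<m. if P i then \<gamma> i else 0)"
  define B where "B = (\<Sum>i<m. if P i then 0 else \<gamma> i)"
  have total: "A + B = (\<Sum>i<m. \<gamma> i)"
    unfolding A_def B_def sum.distrib[symmetric] by (intro sum.cong) auto
  have le: "A + B \<le> N"
    using assms(1,2) unfolding total exponents_def by auto
  have "(\<Sum>i<m. (if P i then 1 else (q - 1) * N) * \<gamma> i) = A + (q - 1) * N * B"
    unfolding A_def B_def sum_distrib_left sum.distrib[symmetric] by (intro sum.cong) auto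
  then have "int q dvd int (A + (q - 1) * N * B)"
    using dvd by (simp only: of_nat_dvd_iff)
  moreover have "int (A + (q - 1) * N * B) = (int A - int (N * B)) + int q * int (N * B)"
    using assms(3) by (cases q) (simp_all add: algebra_simps)
  ultimately have "int q dvd (int A - int (N * B)) + int q * int (N * B)"
    by (simp only:)
  then have *: "int q dvd int A - int (N * B)"
    using dvd_add_left_iff dvd_triv_left by blast
  have "N * B \<le> N * N" "A \<le> N * N"
    using le by (auto intro: order_trans[of A N "N * N"])
  then have "\<bar>int A - int (N * B)\<bar> < int q"
    using assms(3) by linarith
  then have "int A - int (N * B) = 0"
    using * dvd_imp_le_int[of "int A - int (N * B)" "int q"] by fastforce
  then have "A = N * B"
    by (simp only: right_minus_eq of_nat_eq_iff)
  then have "A + B = 0"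
    using le by (cases B) auto
  then have "\<gamma> i = 0" if "i < m" for i
    using that total sum_eq_0_iff[of "{..<m}" \<gamma>] by simp
  moreover have "\<gamma> i = 0" if "\<not> i < m" for i
    using assms(1) that by (auto simp: exponents_def)
  ultimately show ?thesis by blast
qed

section \<open>The module of vectors and multilinear forms\<close>

definition matrix_on :: "(nat \<Rightarrow> 'i) \<Rightarrow> nat \<Rightarrow> ('i \<Rightarrow> 'i \<Rightarrow> 'k) \<Rightarrow> 'k mat" where
  "matrix_on b m M = mat m m (\<lambda>(i, j). M (b i) (b j))"

definition vector_on :: "(nat \<Rightarrow> 'i) \<Rightarrow> nat \<Rightarrow> ('i \<Rightarrow> 'k) \<Rightarrow> 'k vec" where
  "vector_on b m y = vec m (\<lambda>i. y (b i))"

lemma matrix_on_carrier [simp]: "matrix_on b m M \<in> carrier_mat m m"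
  by (simp add: matrix_on_def)

lemma vector_on_carrier [simp]: "vector_on b m y \<in> carrier_vec m"
  by (simp add: vector_on_def)

lemma matrix_on_cong:
  assumes "bij_betw b {..<m} I" "\<And>i j. i \<in> I \<Longrightarrow> j \<in> I \<Longrightarrow> M i j = M' i j"
  shows "matrix_on b m M = matrix_on b m M'"
  unfolding matrix_on_def using assms by (intro eq_matI) (auto simp: bij_betw_apply)

lemma vector_on_cong:
  assumes "bij_betw b {..<m} I" "\<And>i. i \<in> I \<Longrightarrow> y i = y' i"
  shows "vector_on b m y = vector_on b m y'"
  unfolding vector_on_def using assms by (intro eq_vecI) (auto simp: bij_betw_apply)

lemma matrix_on_mult:
  assumes "bij_betw b {..<m} I"
  shows "matrix_on b m M * matrix_on b m M' = matrix_on b m (\<lambda>i j. \<Sum>l\<in>I. M i l * M' l j)"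
  unfolding matrix_on_def
  using sum.reindex_bij_betw[OF assms, of "\<lambda>l. M (b _) l * M' l (b _)"]
  by (intro eq_matI) (simp_all add: scalar_prod_def atLeast0LessThan)

lemma matrix_on_mult_vec:
  assumes "bij_betw b {..<m} I"
  shows "matrix_on b m M *\<^sub>v vector_on b m y = vector_on b m (\<lambda>i. \<Sum>l\<in>I. M i l * y l)"
  unfolding matrix_on_def vector_on_def
  using sum.reindex_bij_betw[OF assms, of "\<lambda>l. M (b _) l * y l"]
  by (intro eq_vecI) (simp_all add: scalar_prod_def atLeast0LessThan)

lemma matrix_on_one:
  assumes "bij_betw b {..<m} I"
  shows "matrix_on b m (\<lambda>i j. if i = j then 1 else 0) = 1\<^sub>m m"
  using assms unfolding matrix_on_def
  by (intro eq_matI) (auto simp: bij_betw_def inj_on_def)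

text \<open>
  Coordinates on \<open>U \<oplus> (U\<^sup>*)\<^sup>\<otimes>\<^sup>N\<close> for \<open>U\<close> of dimension \<open>n\<close>. In \<open>module_entry N g h\<close>, the matrix
  \<open>h\<close> stands for the inverse of \<open>g\<close>.
\<close>

definition module_indices :: "nat \<Rightarrow> nat \<Rightarrow> (nat + (nat \<Rightarrow> nat)) set" where
  "module_indices n N = {..<n} <+> ({..<N} \<rightarrow>\<^sub>E {..<n})"

fun module_entry ::
    "nat \<Rightarrow> 'k::field mat \<Rightarrow> 'k mat \<Rightarrow> nat + (nat \<Rightarrow> nat) \<Rightarrow> nat + (nat \<Rightarrow> nat) \<Rightarrow> 'k" where
  "module_entry N g h (Inl i) (Inl j) = g $$ (i, j)"
| "module_entry N g h (Inr u) (Inr w) = (\<Prod>k<N. h $$ (w k, u k))"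
| "module_entry N g h (Inl i) (Inr w) = 0"
| "module_entry N g h (Inr u) (Inl j) = 0"

lemma finite_module_indices: "finite (module_indices n N)"
  by (simp add: module_indices_def finite_PiE)

lemma sum_module_indices:
  "sum f (module_indices n N) = (\<Sum>i<n. f (Inl i)) + (\<Sum>u\<in>{..<N} \<rightarrow>\<^sub>E {..<n}. f (Inr u))"
  unfolding module_indices_def by (subst sum.Plus) (auto simp: finite_PiE)

lemma sum_prod_multiindices:
  "(\<Sum>u\<in>{..<N} \<rightarrow>\<^sub>E {..<n}. \<Prod>k<N. f k (u k)) = (\<Prod>k<N. \<Sum>i<n. f k i :: 'k::field)" for n N :: nat
  by (rule prod_sum_PiE[symmetric]) auto

lemma module_entry_mult:
  assumes "g \<in> carrier_mat n n" "g' \<in> carrier_mat n n" "h \<in> carrier_mat n n" "h' \<in> carrier_mat n n"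
    and "i \<in> module_indices n N" "j \<in> module_indices n N"
  shows "(\<Sum>l\<in>module_indices n N. module_entry N g h i l * module_entry N g' h' l j) =
    module_entry N (g * g') (h' * h) i j"
proof (cases i; cases j)
  fix i' j' assume ij: "i = Inl i'" "j = Inl j'"
  then have "i' < n" "j' < n"
    using assms(5,6) by (auto simp: module_indices_def)
  then show ?thesis
    using assms(1,2) by (simp add: ij sum_module_indices scalar_prod_def atLeast0LessThan)
next
  fix u w assume ij: "i = Inr u" "j = Inr w"
  then have uw: "u k < n" "w k < n" if "k < N" for k
    using assms(5,6) that by (auto simp: module_indices_def)
  have "(\<Sum>l\<in>module_indices n N. module_entry N g h i l * module_entry N g' h' l j) =
      (\<Sum>x\<in>{..<N} \<rightarrow>\<^sub>E {..<n}. \<Prod>k<N. h' $$ (w k, x k) * h $$ (x k, u k))"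
    by (simp add: ij sum_module_indices prod.distrib mult.commute)
  also have "\<dots> = (\<Prod>k<N. \<Sum>c<n. h' $$ (w k, c) * h $$ (c, u k))"
    by (rule sum_prod_multiindices)
  also have "\<dots> = module_entry N (g * g') (h' * h) i j"
    using assms(3,4) uw by (simp add: ij scalar_prod_def atLeast0LessThan)
  finally show ?thesis .
qed (simp_all add: sum_module_indices)

lemma module_entry_one:
  assumes "i \<in> module_indices n N" "j \<in> module_indices n N"
  shows "module_entry N (1\<^sub>m n) (1\<^sub>m n) i j = (if i = j then 1 else 0 :: 'k::field)"
proof (cases i; cases j)
  fix i' j' assume "i = Inl i'" "j = Inl j'"
  then show ?thesis
    using assms by (auto simp: module_indices_def)
next
  fix u w assume ij: "i = Inr u" "j = Inr w"
  then have uw: "u \<in> {..<N} \<rightarrow>\<^sub>E {..<n}" "w \<in> {..<N} \<rightarrow>\<^sub>E {..<n}"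
    using assms by (auto simp: module_indices_def)
  show ?thesis
  proof (cases "u = w")
    case True
    have "u k < n" if "k < N" for k
      using uw(1) that by auto
    then show ?thesis by (simp add: ij True[symmetric])
  next
    case False
    then obtain k where k: "k < N" "u k \<noteq> w k"
      using PiE_ext[OF uw] by auto
    then have "(\<Prod>k<N. 1\<^sub>m n $$ (w k, u k) :: 'k) = 0"
      using uw by (intro prod_zero) (auto intro!: bexI[of _ k] simp: PiE_iff)
    then show ?thesis
      using False by (simp add: ij)
  qed
qed simp_all

definition module_matrix :: "(nat \<Rightarrow> nat + (nat \<Rightarrow> nat)) \<Rightarrow> nat \<Rightarrow> nat \<Rightarrow> nat \<Rightarrow> 'k::field mat \<Rightarrow> 'k mat" where
  "module_matrix b m n N g = matrix_on b m (module_entry N g (inv\<^bsub>GL n\<^esub> g))"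

lemma module_matrix_representation:
  fixes G :: "'k::field mat set"
  assumes G: "subgroup G (GL n)" and b: "bij_betw b {..<m} (module_indices n N)"
  shows "module_matrix b m n N \<in> rational_representations n G m"
proof -
  interpret GL: Group.group "GL n :: 'k mat monoid" by (rule group_GL)
  have carrier: "A \<in> carrier (GL n)" if "A \<in> G" for A
    using subgroup.subset[OF G] that by blast
  then have mat: "A \<in> carrier_mat n n" if "A \<in> G" for A
    using that by (simp add: carrier_GL_iff)
  have mult: "matrix_on b m (module_entry N g h) * matrix_on b m (module_entry N g' h') =
      matrix_on b m (module_entry N (g * g') (h' * h))"
    if "g \<in> carrier_mat n n" "g' \<in> carrier_mat n n" "h \<in> carrier_mat n n" "h' \<in> carrier_mat n n"
    for g g' h h' :: "'k mat"
    unfolding matrix_on_mult[OF b] by (rule matrix_on_cong[OF b]) (rule module_entry_mult[OF that])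
  have one: "matrix_on b m (module_entry N (1\<^sub>m n) (1\<^sub>m n)) = (1\<^sub>m m :: 'k mat)"
    unfolding matrix_on_one[OF b, symmetric] by (rule matrix_on_cong[OF b]) (rule module_entry_one)
  have "module_matrix b m n N A \<in> carrier (GL m)" if "A \<in> G" for A
    unfolding carrier_GL_iff
  proof (intro conjI bexI)
    let ?A' = "inv\<^bsub>GL n\<^esub> A"
    note A' = GL_inv[OF carrier[OF that]]
    show "matrix_on b m (module_entry N ?A' A) * module_matrix b m n N A = 1\<^sub>m m"
      unfolding module_matrix_def by (subst mult) (use A' mat[OF that] one in simp_all)
    show "module_matrix b m n N A * matrix_on b m (module_entry N ?A' A) = 1\<^sub>m m"
      unfolding module_matrix_def by (subst mult) (use A' mat[OF that] one in simp_all)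
  qed (simp_all add: module_matrix_def)
  moreover have "module_matrix b m n N (A * B) = module_matrix b m n N A * module_matrix b m n N B"
    if "A \<in> G" "B \<in> G" for A B
  proof -
    have "inv\<^bsub>GL n\<^esub> (A * B) = (inv\<^bsub>GL n\<^esub> B) * (inv\<^bsub>GL n\<^esub> A)"
      using GL.inv_mult_group[OF carrier[OF that(1)] carrier[OF that(2)]] by simp
    then show ?thesis
      unfolding module_matrix_def
      using GL_inv(1)[OF carrier[OF that(1)]] GL_inv(1)[OF carrier[OF that(2)]]
        mat[OF that(1)] mat[OF that(2)]
      by (subst mult) simp_all
  qed
  ultimately have hom: "module_matrix b m n N \<in>
      hom (GL n\<lparr>carrier := G\<rparr>) (GL m\<lparr>carrier := carrier (GL m)\<rparr>)"
    by (auto simp: hom_def)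
  have "(\<lambda>A. module_matrix b m n N A $$ (i, j)) \<in> regular_functions n G" if "i < m" "j < m" for i j
  proof -
    have I: "b i \<in> module_indices n N" "b j \<in> module_indices n N"
      using b that by (auto simp: bij_betw_apply)
    have "(\<lambda>A. module_entry N A (inv\<^bsub>GL n\<^esub> A) (b i) (b j)) \<in> regular_functions n G"
      using I
      by (cases "b i"; cases "b j")
        (auto simp: module_indices_def PiE_iff intro!: regular_functions_entry regular_functions_const
          regular_functions_prod regular_functions_inv_entry subgroup.subset[OF G])
    then show ?thesis
      using that by (simp add: module_matrix_def matrix_on_def)
  qed
  with hom show ?thesis
    by (simp add: rational_representations_def algebraic_group_homs_def)
qed

text \<open>The invariant \<open>(x, \<omega>) \<mapsto> \<omega>(x, \<dots>, x)\<close>.\<close>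

definition evaluation :: "nat \<Rightarrow> nat \<Rightarrow> (nat + (nat \<Rightarrow> nat) \<Rightarrow> 'k::field) \<Rightarrow> 'k" where
  "evaluation n N y = (\<Sum>u\<in>{..<N} \<rightarrow>\<^sub>E {..<n}. y (Inr u) * (\<Prod>k<N. y (Inl (u k))))"

lemma evaluation_cong:
  assumes "\<And>x. x \<in> module_indices n N \<Longrightarrow> y x = y' x"
  shows "evaluation n N y = evaluation n N y'"
proof -
  have "(\<Prod>k<N. y (Inl (u k))) = (\<Prod>k<N. y' (Inl (u k)))" if "u \<in> {..<N} \<rightarrow>\<^sub>E {..<n}" for u
    using that by (intro prod.cong assms) (auto simp: module_indices_def)
  then show ?thesis
    unfolding evaluation_def using assms
    by (intro sum.cong refl arg_cong2[of _ _ _ _ "(*)"]) (auto simp: module_indices_def)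
qed

lemma evaluation_invariant:
  assumes g: "g \<in> carrier_mat n n" and h: "h \<in> carrier_mat n n" and hg: "h * g = 1\<^sub>m n"
  shows "evaluation n N (\<lambda>i. \<Sum>l\<in>module_indices n N. module_entry N g h i l * y l) = evaluation n N y"
proof -
  let ?U = "{..<N} \<rightarrow>\<^sub>E {..<n}"
  define x where "x i = (\<Sum>j<n. g $$ (i, j) * y (Inl j))" for i
  have hx: "(\<Sum>i<n. h $$ (c, i) * x i) = y (Inl c)" if "c < n" for c
  proof -
    have "(\<Sum>i<n. h $$ (c, i) * x i) = (\<Sum>j<n. (\<Sum>i<n. h $$ (c, i) * g $$ (i, j)) * y (Inl j))"
      unfolding x_def sum_distrib_left sum_distrib_right by (subst sum.swap) (simp add: mult.assoc)
    also have "\<dots> = (\<Sum>j<n. (h * g) $$ (c, j) * y (Inl j))"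
      using that g h by (intro sum.cong) (simp_all add: scalar_prod_def atLeast0LessThan)
    also have "\<dots> = (\<Sum>j<n. if c = j then y (Inl j) else 0)"
      unfolding hg using that by (intro sum.cong) auto
    finally show ?thesis using that by simp
  qed
  have "evaluation n N (\<lambda>i. \<Sum>l\<in>module_indices n N. module_entry N g h i l * y l) =
      (\<Sum>u\<in>?U. (\<Sum>w\<in>?U. (\<Prod>k<N. h $$ (w k, u k)) * y (Inr w)) * (\<Prod>k<N. x (u k)))"
    by (simp add: evaluation_def sum_module_indices x_def)
  also have "\<dots> = (\<Sum>u\<in>?U. \<Sum>w\<in>?U. y (Inr w) * (\<Prod>k<N. h $$ (w k, u k) * x (u k)))"
    by (simp add: sum_distrib_left sum_distrib_right prod.distrib mult_ac)
  also have "\<dots> = (\<Sum>w\<in>?U. y (Inr w) * (\<Sum>u\<in>?U. \<Prod>k<N. h $$ (w k, u k) * x (u k)))"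
    by (subst sum.swap) (simp add: sum_distrib_left)
  also have "\<dots> = (\<Sum>w\<in>?U. y (Inr w) * (\<Prod>k<N. \<Sum>i<n. h $$ (w k, i) * x i))"
    by (intro sum.cong refl arg_cong[of _ _ "(*) _"] sum_prod_multiindices)
  also have "\<dots> = evaluation n N y"
    unfolding evaluation_def
  proof (intro sum.cong refl arg_cong2[of _ _ _ _ "(*)"] prod.cong)
    fix w k assume "w \<in> ?U" "k \<in> {..<N}"
    then show "(\<Sum>i<n. h $$ (w k, i) * x i) = y (Inl (w k))"
      by (intro hx) auto
  qed
  finally show ?thesis .
qed

lemma evaluation_invariant_function:
  fixes G :: "'k::field mat set"
  assumes G: "subgroup G (GL n)" and b: "bij_betw b {..<m} (module_indices n N)"
  obtains F where "F \<in> invariants n G m (module_matrix b m n N)"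
    and "\<forall>y. F (vector_on b m y) = evaluation n N y"
proof
  define b' where "b' = inv_into {..<m} b"
  have b': "b' x < m" "b (b' x) = x" if "x \<in> module_indices n N" for x
    using b that bij_betw_inv_into_right[OF b] bij_betw_apply[OF bij_betw_inv_into[OF b]]
    by (auto simp: b'_def)
  define F where "F v = evaluation n N (\<lambda>x. v $ b' x)" for v :: "'k vec"
  have F_vec: "F (vector_on b m y) = evaluation n N y" for y
    unfolding F_def by (rule evaluation_cong) (simp add: vector_on_def b')
  then show "\<forall>y. F (vector_on b m y) = evaluation n N y"
    by blast
  have coordinate: "(\<lambda>v. v $ b' x) \<in> polynomial_functions (\<lambda>i v. v $ i) {..<m} (carrier_vec m)"
    if "x \<in> module_indices n N" for x
    by (rule polynomial_functions_coordinate) (simp_all add: b'(1)[OF that])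
  have "F \<in> polynomial_functions (\<lambda>i v. v $ i) {..<m} (carrier_vec m)"
    unfolding F_def evaluation_def
  proof (intro polynomial_functions_sum polynomial_functions_mult polynomial_functions_prod coordinate
      finite_lessThan)
    fix u k assume u: "u \<in> {..<N} \<rightarrow>\<^sub>E {..<n}"
    then show "Inr u \<in> module_indices n N"
      by (auto simp: module_indices_def)
    assume "k \<in> {..<N}"
    then show "Inl (u k) \<in> module_indices n N"
      using u by (auto simp: module_indices_def)
  qed
  then obtain d where "F \<in> vector_polynomials_le m d"
    unfolding vector_polynomials_le_def by blast
  moreover have "F (module_matrix b m n N (inv\<^bsub>GL n\<^esub> g) *\<^sub>v v) = F v"
    if "g \<in> G" "v \<in> carrier_vec m" for g v
  proof -
    define g' where "g' = inv\<^bsub>GL n\<^esub> g"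
    have "g' \<in> carrier (GL n)"
      using subgroup.m_inv_closed[OF G that(1)] subgroup.subset[OF G] by (auto simp: g'_def)
    then have g': "g' \<in> carrier_mat n n" "inv\<^bsub>GL n\<^esub> g' \<in> carrier_mat n n"
        "inv\<^bsub>GL n\<^esub> g' * g' = 1\<^sub>m n"
      by (simp_all add: carrier_GL_iff[THEN iffD1] GL_inv)
    define y where "y x = v $ b' x" for x
    have v: "v = vector_on b m y"
      using that(2) b by (intro eq_vecI)
        (auto simp: vector_on_def y_def b'_def bij_betw_inv_into_left[OF b])
    show ?thesis
      unfolding g'_def[symmetric] module_matrix_def v matrix_on_mult_vec[OF b] F_vec
      by (rule evaluation_invariant[OF g'])
  qed
  ultimately show "F \<in> invariants n G m (module_matrix b m n N)"
    unfolding invariants_def invariants_le_def by blast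
qed

text \<open>The vector \<open>(\<alpha> e, \<beta> \<epsilon>\<^sup>\<otimes>\<^sup>N)\<close>.\<close>

definition test_vector ::
    "nat \<Rightarrow> (nat \<Rightarrow> 'k) \<Rightarrow> (nat \<Rightarrow> 'k) \<Rightarrow> 'k \<Rightarrow> 'k::field \<Rightarrow> nat + (nat \<Rightarrow> nat) \<Rightarrow> 'k" where
  "test_vector N e \<epsilon> \<alpha> \<beta> = case_sum (\<lambda>i. \<alpha> * e i) (\<lambda>u. \<beta> * (\<Prod>k<N. \<epsilon> (u k)))"

lemma evaluation_test_vector:
  "evaluation n N (test_vector N e \<epsilon> 1 1) = (\<Sum>i<n. \<epsilon> i * e i) ^ N"
proof -
  have "evaluation n N (test_vector N e \<epsilon> 1 1) =
      (\<Sum>u\<in>{..<N} \<rightarrow>\<^sub>E {..<n}. \<Prod>k<N. \<epsilon> (u k) * e (u k))"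
    by (simp add: evaluation_def test_vector_def prod.distrib)
  also have "\<dots> = (\<Sum>i<n. \<epsilon> i * e i) ^ N"
    by (subst sum_prod_multiindices) simp
  finally show ?thesis .
qed

lemma module_entry_test_vector:
  assumes e: "\<And>a. a < n \<Longrightarrow> (\<Sum>b<n. g $$ (a, b) * e b) = \<kappa> * e a"
    and \<epsilon>: "\<And>b. b < n \<Longrightarrow> (\<Sum>a<n. \<epsilon> a * h $$ (a, b)) = \<kappa>' * \<epsilon> b"
    and "i \<in> module_indices n N"
  shows "(\<Sum>l\<in>module_indices n N. module_entry N g h i l * test_vector N e \<epsilon> \<alpha> \<beta> l) =
    test_vector N e \<epsilon> (\<kappa> * \<alpha>) (\<kappa>' ^ N * \<beta>) i"
proof (cases i)
  case (Inl a)
  then have "a < n" using assms(3) by (auto simp: module_indices_def)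
  have "(\<Sum>j<n. g $$ (a, j) * (\<alpha> * e j)) = \<alpha> * (\<Sum>j<n. g $$ (a, j) * e j)"
    by (simp add: sum_distrib_left mult_ac)
  then show ?thesis
    using e[OF \<open>a < n\<close>] by (simp add: Inl sum_module_indices test_vector_def mult_ac)
next
  case (Inr u)
  then have u: "u k < n" if "k < N" for k
    using assms(3) that by (auto simp: module_indices_def)
  have "(\<Sum>w\<in>{..<N} \<rightarrow>\<^sub>E {..<n}. (\<Prod>k<N. h $$ (w k, u k)) * (\<beta> * (\<Prod>k<N. \<epsilon> (w k)))) =
      \<beta> * (\<Sum>w\<in>{..<N} \<rightarrow>\<^sub>E {..<n}. \<Prod>k<N. \<epsilon> (w k) * h $$ (w k, u k))"
    by (simp add: sum_distrib_left prod.distrib mult_ac)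
  also have "\<dots> = \<beta> * (\<Prod>k<N. \<kappa>' * \<epsilon> (u k))"
    by (subst sum_prod_multiindices) (use \<epsilon> u in simp)
  finally show ?thesis
    by (simp add: Inr sum_module_indices test_vector_def prod.distrib mult_ac)
qed

lemma dual_eigenvector_inverse:
  fixes t h :: "'k::field mat"
  assumes t: "t \<in> carrier_mat n n" and h: "h \<in> carrier_mat n n" and th: "t * h = 1\<^sub>m n"
    and \<epsilon>: "\<And>b. b < n \<Longrightarrow> (\<Sum>a<n. \<epsilon> a * t $$ (a, b)) = \<kappa> * \<epsilon> b"
    and \<kappa>: "\<kappa>' * \<kappa> = 1" and "b < n"
  shows "(\<Sum>a<n. \<epsilon> a * h $$ (a, b)) = \<kappa>' * \<epsilon> b"
proof -
  have "\<epsilon> b = (\<Sum>a<n. if a = b then \<epsilon> a else 0)"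
    using \<open>b < n\<close> by simp
  also have "\<dots> = (\<Sum>a<n. \<epsilon> a * (t * h) $$ (a, b))"
    unfolding th using \<open>b < n\<close> by (intro sum.cong) auto
  also have "\<dots> = (\<Sum>a<n. \<Sum>c<n. \<epsilon> a * (t $$ (a, c) * h $$ (c, b)))"
    using t h \<open>b < n\<close> by (simp add: scalar_prod_def atLeast0LessThan sum_distrib_left)
  also have "\<dots> = (\<Sum>c<n. (\<Sum>a<n. \<epsilon> a * t $$ (a, c)) * h $$ (c, b))"
    by (subst sum.swap) (simp add: sum_distrib_right mult.assoc)
  also have "\<dots> = \<kappa> * (\<Sum>c<n. \<epsilon> c * h $$ (c, b))"
    using \<epsilon> by (simp add: sum_distrib_left mult.assoc)
  finally have "\<kappa>' * \<epsilon> b = (\<kappa>' * \<kappa>) * (\<Sum>c<n. \<epsilon> c * h $$ (c, b))"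
    by (simp only: mult.assoc)
  then show ?thesis by (simp add: \<kappa>)
qed

lemma low_degree_invariant_vanishes_at_test_vector:
  fixes G :: "'k::field mat set"
  assumes G: "subgroup G (GL n)" and b: "bij_betw b {..<m} (module_indices n N)"
    and t: "t \<in> G" and q: "prime q" "of_nat q \<noteq> (0 :: 'k)" "N * N < q"
    and \<kappa>: "\<kappa> ^ q = 1" "\<kappa> \<noteq> 1"
    and e: "\<And>a. a < n \<Longrightarrow> (\<Sum>b<n. t $$ (a, b) * e b) = \<kappa> * e a"
    and \<epsilon>: "\<And>b. b < n \<Longrightarrow> (\<Sum>a<n. \<epsilon> a * t $$ (a, b)) = \<kappa> * \<epsilon> b"
    and f: "f \<in> invariants_le n G m (module_matrix b m n N) d" "f (0\<^sub>v m) = 0" and d: "d \<le> N"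
  shows "f (vector_on b m (test_vector N e \<epsilon> 1 1)) = 0"
proof -
  interpret GL: Group.group "GL n :: 'k mat monoid" by (rule group_GL)
  have tGL: "t \<in> carrier (GL n)"
    using subgroup.subset[OF G] t by blast
  let ?h = "inv\<^bsub>GL n\<^esub> t"
  let ?\<kappa>' = "\<kappa> ^ (q - 1)"
  have "?\<kappa>' * \<kappa> = 1"
    using \<kappa>(1) prime_gt_0_nat[OF q(1)] by (metis power_minus_mult)
  then have \<epsilon>h: "(\<Sum>a<n. \<epsilon> a * ?h $$ (a, b)) = ?\<kappa>' * \<epsilon> b" if "b < n" for b
    using dual_eigenvector_inverse[OF _ GL_inv(1)[OF tGL] GL_inv(2)[OF tGL] \<epsilon> _ that] tGL
    by (simp add: carrier_GL_iff)
  let ?v = "\<lambda>\<alpha> \<beta>. vector_on b m (test_vector N e \<epsilon> \<alpha> \<beta>)"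
  have act: "module_matrix b m n N t *\<^sub>v ?v \<alpha> \<beta> = ?v (\<kappa> * \<alpha>) (?\<kappa>' ^ N * \<beta>)" for \<alpha> \<beta>
    unfolding module_matrix_def matrix_on_mult_vec[OF b]
    by (rule vector_on_cong[OF b], rule module_entry_test_vector[OF e \<epsilon>h])
  have step: "f (?v (\<kappa> * \<alpha>) (?\<kappa>' ^ N * \<beta>)) = f (?v \<alpha> \<beta>)" for \<alpha> \<beta>
  proof -
    have "f (module_matrix b m n N (inv\<^bsub>GL n\<^esub> ?h) *\<^sub>v ?v \<alpha> \<beta>) = f (?v \<alpha> \<beta>)"
      using f(1) subgroup.m_inv_closed[OF G t] by (simp add: invariants_le_def)
    then show ?thesis
      using act GL.inv_inv[OF tGL] by simp
  qed
  have orbit: "f (?v (\<kappa> ^ k) ((?\<kappa>' ^ N) ^ k)) = f (?v 1 1)" for k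
  proof (induction k)
    case (Suc k)
    then show ?case
      using step[of "\<kappa> ^ k" "(?\<kappa>' ^ N) ^ k"] by (simp only: power_Suc)
  qed simp
  define w where "w i = (if isl (b i) then 1 else (q - 1) * N)" for i
  show ?thesis
  proof (rule cyclic_invariant_vanishes)
    show "f \<in> vector_polynomials_le m d"
      using f(1) by (simp add: invariants_le_def)
    show "f (vec m (\<lambda>i. \<kappa> ^ (k * w i) * ?v 1 1 $ i)) = f (?v 1 1)" for k
    proof -
      have "vec m (\<lambda>i. \<kappa> ^ (k * w i) * ?v 1 1 $ i) = ?v (\<kappa> ^ k) ((?\<kappa>' ^ N) ^ k)"
        by (rule eq_vecI)
          (auto simp: vector_on_def test_vector_def w_def power_mult[symmetric] mult_ac split: sum.split)
      then show ?thesis using orbit by simp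
    qed
    show "\<gamma> = (\<lambda>_. 0)" if "\<gamma> \<in> exponents {..<m} d" "q dvd (\<Sum>i<m. w i * \<gamma> i)" for \<gamma>
      by (rule weight_of_low_degree_exponent[OF that(1) d q(3), of "\<lambda>i. isl (b i)"])
        (use that(2) in \<open>simp only: w_def\<close>)
  qed (use f q \<kappa> in simp_all)
qed

lemma sigma_module_lower_bound:
  fixes G :: "'k::alg_closed_field mat set"
  assumes G: "subgroup G (GL n)" and T: "T \<subseteq> G" "torus n T" "T \<noteq> {1\<^sub>m n}"
  obtains m \<rho> where "\<rho> \<in> rational_representations n G m" "enat N \<le> sigma_module n G m \<rho>"
proof -
  obtain q where q: "prime q" "q > N * N" "of_nat q \<noteq> (0 :: 'k)"
    by (rule exists_large_invertible_prime)
  obtain t where t: "t \<in> T" "t ^\<^sub>m q = 1\<^sub>m n" "t \<noteq> 1\<^sub>m n"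
    using torus_element_of_prime_order[OF T(2,3) q(1,3)] .
  have tG: "t \<in> G" using t(1) T(1) by blast
  then have t_mat: "t \<in> carrier_mat n n"
    using subgroup.subset[OF G] carrier_GL_iff by blast
  obtain \<kappa> e \<epsilon> where \<kappa>: "\<kappa> ^ q = 1" "\<kappa> \<noteq> 1"
    and e: "\<forall>a<n. (\<Sum>b<n. t $$ (a, b) * e b) = \<kappa> * e a"
    and \<epsilon>: "\<forall>b<n. (\<Sum>a<n. \<epsilon> a * t $$ (a, b)) = \<kappa> * \<epsilon> b"
    and nz: "(\<Sum>b<n. \<epsilon> b * e b) \<noteq> 0"
    using dual_eigenvectors[OF t_mat t(2,3) q(1,3)] .
  define m where "m = card (module_indices n N)"
  obtain b where b: "bij_betw b {..<m} (module_indices n N)"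
    using ex_bij_betw_nat_finite[OF finite_module_indices[of n N]]
    by (auto simp: m_def atLeast0LessThan)
  let ?\<rho> = "module_matrix b m n N :: 'k mat \<Rightarrow> 'k mat"
  let ?v = "vector_on b m (test_vector N e \<epsilon> 1 1)"
  obtain F where F: "F \<in> invariants n G m ?\<rho>" "\<forall>y. F (vector_on b m y) = evaluation n N y"
    using evaluation_invariant_function[OF G b] .
  have "0\<^sub>v m = vector_on b m (\<lambda>_. 0 :: 'k)"
    by (rule eq_vecI) (simp_all add: vector_on_def)
  then have "F (0\<^sub>v m) = 0"
    by (simp add: F(2) evaluation_def)
  moreover have "F ?v \<noteq> 0"
    using nz by (simp add: F(2) evaluation_test_vector)
  ultimately have v: "?v \<in> carrier_vec m - nullcone n G m ?\<rho>"
    using F(1) by (auto simp: nullcone_def plus_part_def)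
  have "enat N \<le> enat d" if sigma: "sigma_set n G m ?\<rho> (invariants_le n G m ?\<rho> d)" for d
  proof (rule ccontr)
    assume "\<not> enat N \<le> enat d"
    then have d: "d \<le> N" by simp
    obtain f where "f \<in> plus_part m (invariants_le n G m ?\<rho> d)" "f ?v \<noteq> 0"
      using sigma v unfolding sigma_set_def by blast
    then show False
      using low_degree_invariant_vanishes_at_test_vector[OF G b tG q(1,3,2) \<kappa> e[rule_format] \<epsilon>[rule_format] _ _ d]
      by (simp add: plus_part_def)
  qed
  then have "enat N \<le> sigma_module n G m ?\<rho>"
    unfolding sigma_module_def by (intro INF_greatest) simp
  with module_matrix_representation[OF G b] show ?thesis
    by (rule that)
qed

theorem proposition4p2:
  fixes n :: nat and G :: "'k::alg_closed_field mat set"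
  assumes "linear_algebraic_group n G"
    and "\<exists>T. T \<subseteq> G \<and> torus n T \<and> T \<noteq> {1\<^sub>m n}"
  shows "sigma_group n G = \<infinity>"
proof -
  obtain T where T: "T \<subseteq> G" "torus n T" "T \<noteq> {1\<^sub>m n}"
    using assms(2) by blast
  have G: "subgroup G (GL n)"
    using assms(1) by (simp add: linear_algebraic_group_def)
  have "enat N \<le> sigma_group n G" for N
  proof -
    obtain m \<rho> where \<rho>: "\<rho> \<in> rational_representations n G m" "enat N \<le> sigma_module n G m \<rho>"
      using sigma_module_lower_bound[OF G T] .
    then have "sigma_module n G m \<rho> \<le> sigma_group n G"
      unfolding sigma_group_def by (intro SUP_upper2[of "(m, \<rho>)"]) auto
    with \<rho>(2) show ?thesis by (rule order_trans)
  qed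
  then have "sigma_group n G \<noteq> enat N" for N
    by (metis Suc_n_not_le_n enat_ord_simps(1))
  then show ?thesis
    by (cases "sigma_group n G") auto
qed

end
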